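(* Let $a,b$ be constants, let $\Gamma\subset\mathbb{R}^2$ be a non-singular real-analytic curve, and let $U\subset\mathbb{R}^2$ be a reflection neighbourhood for $\Gamma$ (see context). Let $u$ be any solution in $U$ of $$\Delta u+a u_x+b u_y+\frac{a^2+b^2}{4}\,u=0$$ vanishing on $\Gamma$. Then for every $P=(x_0,y_0)\in U$, with $z_0=x_0+iy_0$, $\zeta_0=x_0-iy_0$ and $Q=R(P)$, $$u(P)=-e^{A(S(z_0)-\zeta_0)+B(\widetilde S(\zeta_0)-z_0)}\,u(Q),$$ where $A=\frac14(a+ib)$ and $B=\frac14(a-ib)$.
   Context: Let $\Gamma=\{f(x,y)=0\}$ with $f$ real-analytic and $\operatorname{grad} f\neq0$ on $\Gamma$. With $z=x+iy$, $\zeta=x-iy$, the complexified equation $f\left(\frac{z+\zeta}{2},\frac{z-\zeta}{2i}\right)=0$ can be solved near $\Gamma$ as $\zeta=S(z)$ or $z=\widetilde S(\zeta)$, with $S$, $\widetilde S$ holomorphic and mutually inverse; $S$ is the Schwarz function of $\Gamma$. The reflection is $R(x,y)=R(z)=\overline{S(z)}$, where $(x,y)$ is identified with $z=x+iy$. Reflection neighbourhood: a simply connected neighbourhood $U\subset\mathbb{R}^2\cong\mathbb{C}$ of a point of $\Gamma$ such that $\Gamma\cap U$ is connected and divides $U$ into two components $U_1,U_2$, $S$ is holomorphic on $U$, and $R:U\to U$ is an anti-conformal involution that is the identity on $\Gamma\cap U$ and interchanges $U_1$ and $U_2$. *)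

theory Defs
  imports "HOL-Complex_Analysis.Complex_Analysis"
begin

text \<open>The plane is identified with the type \<^typ>\<open>complex\<close> throughout: the point $(x,y)$ is
  \<^term>\<open>Complex x y\<close>, and a function of $(x,y)$ is a function on \<^typ>\<open>complex\<close>.\<close>

definition partial_x :: "(complex \<Rightarrow> 'a::real_normed_vector) \<Rightarrow> complex \<Rightarrow> 'a" where
  "partial_x u z = vector_derivative (\<lambda>t::real. u (z + of_real t)) (at 0)"

definition partial_y :: "(complex \<Rightarrow> 'a::real_normed_vector) \<Rightarrow> complex \<Rightarrow> 'a" where
  "partial_y u z = vector_derivative (\<lambda>t::real. u (z + \<i> * of_real t)) (at 0)"

definition C1_on :: "complex set \<Rightarrow> (complex \<Rightarrow> 'a::real_normed_vector) \<Rightarrow> bool" where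
  "C1_on U u \<longleftrightarrow>
     (\<forall>z\<in>U. (\<lambda>t::real. u (z + of_real t)) differentiable (at 0) \<and>
            (\<lambda>t::real. u (z + \<i> * of_real t)) differentiable (at 0)) \<and>
     continuous_on U (partial_x u) \<and> continuous_on U (partial_y u)"

definition C2_on :: "complex set \<Rightarrow> (complex \<Rightarrow> 'a::real_normed_vector) \<Rightarrow> bool" where
  "C2_on U u \<longleftrightarrow> C1_on U u \<and> C1_on U (partial_x u) \<and> C1_on U (partial_y u)"

definition laplacian :: "(complex \<Rightarrow> 'a::real_normed_vector) \<Rightarrow> complex \<Rightarrow> 'a" where
  "laplacian u z = partial_x (partial_x u) z + partial_y (partial_y u) z"

definition grad :: "(complex \<Rightarrow> real) \<Rightarrow> complex \<Rightarrow> real \<times> real" where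
  "grad f z = (partial_x f z, partial_y f z)"

text \<open>Real analyticity in two real variables; \<^term>\<open>c m n\<close> is the coefficient of
  $(x-x_0)^m (y-y_0)^n$ in the Taylor expansion at $p=(x_0,y_0)$.\<close>

definition taylor_expansion ::
    "(complex \<Rightarrow> real) \<Rightarrow> complex \<Rightarrow> (nat \<Rightarrow> nat \<Rightarrow> real) \<Rightarrow> real \<Rightarrow> bool" where
  "taylor_expansion f p c r \<longleftrightarrow> r > 0 \<and>
     (\<forall>x y. \<bar>x - Re p\<bar> < r \<and> \<bar>y - Im p\<bar> < r \<longrightarrow>
        ((\<lambda>(m, n). c m n * (x - Re p) ^ m * (y - Im p) ^ n) has_sum f (Complex x y)) UNIV)"

definition real_analytic_on :: "(complex \<Rightarrow> real) \<Rightarrow> complex set \<Rightarrow> bool" where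
  "real_analytic_on f D \<longleftrightarrow> (\<forall>p\<in>D. \<exists>c r. taylor_expansion f p c r)"

definition nonsingular_analytic_curve ::
    "complex set \<Rightarrow> (complex \<Rightarrow> real) \<Rightarrow> complex set \<Rightarrow> bool" where
  "nonsingular_analytic_curve D f \<Gamma> \<longleftrightarrow>
     open D \<and> real_analytic_on f D \<and> \<Gamma> = {p\<in>D. f p = 0} \<and> (\<forall>p\<in>\<Gamma>. grad f p \<noteq> 0)"

text \<open>The extension of $f$ to complex values $X$, $Y$ of its two variables near $p$: the sum of
  the Taylor series of $f$ at $p$.  If \<^term>\<open>taylor_expansion f p c r\<close> holds, the series converges
  absolutely for $|X-x_0|<r$, $|Y-y_0|<r$.\<close>

definition complexification ::
    "(nat \<Rightarrow> nat \<Rightarrow> real) \<Rightarrow> complex \<Rightarrow> complex \<Rightarrow> complex \<Rightarrow> complex" where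
  "complexification c p X Y =
     (\<Sum>\<^sub>\<infinity>(m, n)\<in>UNIV. of_real (c m n) * (X - of_real (Re p)) ^ m * (Y - of_real (Im p)) ^ n)"

text \<open>Near $(p, \overline p)$ the complexified equation is equivalent to $\zeta=S(z)$ and to
  $z=S'(\zeta)$.  The bound \<^term>\<open>\<epsilon> \<le> r\<close> keeps both arguments of the complexification inside its
  polydisc of convergence.\<close>

definition solves_complexified_at ::
    "(complex \<Rightarrow> real) \<Rightarrow> complex \<Rightarrow> (complex \<Rightarrow> complex) \<Rightarrow> (complex \<Rightarrow> complex) \<Rightarrow> bool" where
  "solves_complexified_at f p S S' \<longleftrightarrow>
     (\<exists>c r \<epsilon>. taylor_expansion f p c r \<and> 0 < \<epsilon> \<and> \<epsilon> \<le> r \<and>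
        (\<forall>z\<in>ball p \<epsilon>. \<forall>\<zeta>\<in>ball (cnj p) \<epsilon>.
           (complexification c p ((z + \<zeta>) / 2) ((z - \<zeta>) / (2 * \<i>)) = 0 \<longleftrightarrow> \<zeta> = S z) \<and>
           (complexification c p ((z + \<zeta>) / 2) ((z - \<zeta>) / (2 * \<i>)) = 0 \<longleftrightarrow> z = S' \<zeta>)))"

text \<open>$S$ is the Schwarz function of $\Gamma$ and $S'$ its inverse (written $\widetilde S$ on
  paper).  The complexified equation determines them only near $\Gamma$; on \<^term>\<open>U\<close> and on the
  conjugate domain \<^term>\<open>cnj ` U\<close>, which is where $\zeta=x-iy$ ranges, they are the analytic
  continuations.\<close>

definition schwarz_pair_on ::
    "complex set \<Rightarrow> (complex \<Rightarrow> real) \<Rightarrow> complex set \<Rightarrow>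
     (complex \<Rightarrow> complex) \<Rightarrow> (complex \<Rightarrow> complex) \<Rightarrow> bool" where
  "schwarz_pair_on U f \<Gamma> S S' \<longleftrightarrow>
     S holomorphic_on U \<and> S' holomorphic_on (cnj ` U) \<and>
     (\<forall>z\<in>U. S z \<in> cnj ` U \<and> S' (S z) = z) \<and>
     (\<forall>\<zeta>\<in>cnj ` U. S' \<zeta> \<in> U \<and> S (S' \<zeta>) = \<zeta>) \<and>
     (\<forall>p\<in>\<Gamma> \<inter> U. solves_complexified_at f p S S')"

definition reflection :: "(complex \<Rightarrow> complex) \<Rightarrow> complex \<Rightarrow> complex" where
  "reflection S z = cnj (S z)"

definition anticonformal_on :: "(complex \<Rightarrow> complex) \<Rightarrow> complex set \<Rightarrow> bool" where
  "anticonformal_on g U \<longleftrightarrow>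
     (\<lambda>z. cnj (g z)) holomorphic_on U \<and> (\<forall>z\<in>U. deriv (\<lambda>z. cnj (g z)) z \<noteq> 0)"

definition reflection_neighbourhood ::
    "(complex \<Rightarrow> real) \<Rightarrow> complex set \<Rightarrow> (complex \<Rightarrow> complex) \<Rightarrow> (complex \<Rightarrow> complex) \<Rightarrow>
     complex set \<Rightarrow> bool" where
  "reflection_neighbourhood f \<Gamma> S S' U \<longleftrightarrow>
     open U \<and> simply_connected U \<and> \<Gamma> \<inter> U \<noteq> {} \<and> connected (\<Gamma> \<inter> U) \<and>
     schwarz_pair_on U f \<Gamma> S S' \<and>
     reflection S ` U \<subseteq> U \<and> anticonformal_on (reflection S) U \<and>
     (\<forall>z\<in>U. reflection S (reflection S z) = z) \<and>
     (\<forall>z\<in>\<Gamma> \<inter> U. reflection S z = z) \<and>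
     (\<exists>U1 U2. components (U - \<Gamma>) = {U1, U2} \<and> U1 \<noteq> U2 \<and>
        reflection S ` U1 = U2 \<and> reflection S ` U2 = U1)"

end

theory Submission
  imports Defs
begin

text \<open>The function $v(x,y) = u(x,y)\, e^{(ax+by)/2}$ is harmonic and vanishes on $\Gamma$, and the claim
  is $v(P) = -v(R(P))$.  After splitting off real and imaginary parts, $v = \mathrm{Re}\, G$ with $G$
  holomorphic on the simply connected $U$.  The function
  $H(z) = G(z) + \overline{G(R(z))}$ is holomorphic, and on $\Gamma$ it equals $2\,\mathrm{Re}\, G = 0$;
  hence $H = 0$ on $U$, and the real part of this is the claim.  The identity principle applies because
  $\Gamma \cap U$ is connected and cannot be a single point, whose removal would not disconnect $U$.\<close>

section \<open>Total derivatives from continuous partial derivatives\<close>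

abbreviation has_partials ::
    "(complex \<Rightarrow> 'a::real_normed_vector) \<Rightarrow> 'a \<Rightarrow> 'a \<Rightarrow> complex \<Rightarrow> bool" where
  "has_partials f fx fy z \<equiv> (f has_derivative (\<lambda>h. Re h *\<^sub>R fx + Im h *\<^sub>R fy)) (at z)"

text \<open>\<open>C1_on\<close> speaks only of derivatives along the two axis directions. In
  product coordinates, existence of the partials together with continuity of one of them gives a
  total derivative; composing with \<open>(Re w, Im w)\<close> carries it back to the complex
  plane.\<close>

lemma C1_on_has_partials:
  fixes u :: "complex \<Rightarrow> 'a::real_normed_vector"
  assumes "open U" "C1_on U u" "z \<in> U"
  shows "has_partials u (partial_x u z) (partial_y u z) z"
proof -
  have "open ((\<lambda>(x, y). Complex x y) -` U)"
    using \<open>open U\<close> by (intro open_vimage) (auto simp: case_prod_unfold Complex_eq intro!: continuous_intros)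
  moreover have "(Re z, Im z) \<in> (\<lambda>(x, y). Complex x y) -` U"
    using \<open>z \<in> U\<close> by simp
  ultimately obtain X0 Y0 where XY0: "open X0" "open Y0" "(Re z, Im z) \<in> X0 \<times> Y0"
      "X0 \<times> Y0 \<subseteq> (\<lambda>(x, y). Complex x y) -` U"
    by (rule open_prod_elim)
  then obtain d e where "d > 0" "ball (Re z) d \<subseteq> X0" "e > 0" "ball (Im z) e \<subseteq> Y0"
    by (meson SigmaD1 SigmaD2 open_contains_ball)
  \<comment> \<open>A box inside \<open>U\<close>, with intervals as factors: the criterion for
    total differentiability needs the second factor convex.\<close>
  define X Y where "X = ball (Re z) d" and "Y = ball (Im z) e"
  have zX: "Re z \<in> X" and zY: "Im z \<in> Y" and oX: "open X" and oY: "open Y" and cY: "convex Y"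
    using \<open>d > 0\<close> \<open>e > 0\<close> by (auto simp: X_def Y_def)
  have XYU: "Complex x y \<in> U" if "x \<in> X" "y \<in> Y" for x y
  proof -
    have "(x, y) \<in> X0 \<times> Y0"
      using that \<open>ball (Re z) d \<subseteq> X0\<close> \<open>ball (Im z) e \<subseteq> Y0\<close> unfolding X_def Y_def by blast
    then show ?thesis using XY0(4) by auto
  qed
  have px: "((\<lambda>x. u (Complex x y)) has_derivative (\<lambda>t. t *\<^sub>R partial_x u (Complex x y))) (at x)"
    if "x \<in> X" "y \<in> Y" for x y
  proof -
    \<comment> \<open>The base point 0 is written \<open>x - x\<close>, so that the chain rule for
      the shift \<open>w - x\<close> matches at \<open>x\<close>.\<close>
    have "((\<lambda>t::real. u (Complex x y + of_real t)) has_vector_derivative partial_x u (Complex x y)) (at (x - x))"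
      using \<open>C1_on U u\<close> XYU[OF that] vector_derivative_works
      unfolding C1_on_def partial_x_def by fastforce
    then have "((\<lambda>t. u (Complex x y + of_real t)) \<circ> (\<lambda>w. w - x) has_derivative
        (\<lambda>t. t *\<^sub>R partial_x u (Complex x y)) \<circ> (\<lambda>t. t)) (at x)"
      unfolding has_vector_derivative_def
      by (intro diff_chain_at) (auto intro!: derivative_eq_intros)
    moreover have "(\<lambda>t. u (Complex x y + of_real t)) \<circ> (\<lambda>w. w - x) = (\<lambda>x. u (Complex x y))"
      by (auto simp: fun_eq_iff complex_eq_iff intro!: arg_cong[where f = u])
    ultimately show ?thesis by (simp add: o_def)
  qed
  \<comment> \<open>Here the derivative is a bounded linear map as an object, because its continuity
    in the point \<open>(x, y)\<close> has to be expressed.\<close>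
  have py: "((\<lambda>y. u (Complex x y)) has_derivative
      blinfun_apply (blinfun_scaleR_left (partial_y u (Complex x y)))) (at y)"
    if "x \<in> X" "y \<in> Y" for x y
  proof -
    have "((\<lambda>t::real. u (Complex x y + \<i> * of_real t)) has_vector_derivative partial_y u (Complex x y)) (at (y - y))"
      using \<open>C1_on U u\<close> XYU[OF that] vector_derivative_works
      unfolding C1_on_def partial_y_def by fastforce
    then have "((\<lambda>t. u (Complex x y + \<i> * of_real t)) \<circ> (\<lambda>w. w - y) has_derivative
        (\<lambda>t. t *\<^sub>R partial_y u (Complex x y)) \<circ> (\<lambda>t. t)) (at y)"
      unfolding has_vector_derivative_def
      by (intro diff_chain_at) (auto intro!: derivative_eq_intros)
    moreover have "(\<lambda>t. u (Complex x y + \<i> * of_real t)) \<circ> (\<lambda>w. w - y) = (\<lambda>y. u (Complex x y))"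
      by (auto simp: fun_eq_iff complex_eq_iff intro!: arg_cong[where f = u])
    ultimately show ?thesis by (simp add: o_def)
  qed
  have "continuous_on (X \<times> Y) (partial_y u \<circ> (\<lambda>(x, y). Complex x y))"
    using \<open>C1_on U u\<close> XYU
    by (intro continuous_on_compose continuous_on_subset[where t = "(\<lambda>(x, y). Complex x y) ` (X \<times> Y)"])
       (auto simp: C1_on_def case_prod_unfold Complex_eq intro!: continuous_intros
             elim!: continuous_on_subset)
  then have "continuous_on (X \<times> Y) (\<lambda>(x, y). blinfun_scaleR_left (partial_y u (Complex x y)))"
    by (auto simp: case_prod_unfold o_def intro!: continuous_intros)
  then have cont: "continuous (at (Re z, Im z) within X \<times> Y)
      (\<lambda>(x, y). blinfun_scaleR_left (partial_y u (Complex x y)))"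
    using zX zY by (auto simp: continuous_on_eq_continuous_within)
  have "((\<lambda>(x, y). u (Complex x y)) has_derivative
      (\<lambda>(tx, ty). tx *\<^sub>R partial_x u z + blinfun_apply (blinfun_scaleR_left (partial_y u (Complex (Re z) (Im z)))) ty))
      (at (Re z, Im z) within X \<times> Y)"
    using has_derivative_at_withinI[OF px[OF zX zY], of X] has_derivative_at_withinI[OF py] cont zY cY
    by (intro has_derivative_partialsI) auto
  then have "((\<lambda>(x, y). u (Complex x y)) has_derivative
      (\<lambda>(tx, ty). tx *\<^sub>R partial_x u z + ty *\<^sub>R partial_y u z)) (at (Re z, Im z))"
    using zX zY oX oY by (subst (asm) at_within_open) (auto simp: open_Times)
  then have "((\<lambda>(x, y). u (Complex x y)) \<circ> (\<lambda>w. (Re w, Im w)) has_derivative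
      (\<lambda>(tx, ty). tx *\<^sub>R partial_x u z + ty *\<^sub>R partial_y u z) \<circ> (\<lambda>h. (Re h, Im h))) (at z)"
    by (intro diff_chain_at) (auto intro!: derivative_eq_intros)
  then show ?thesis by (simp add: o_def)
qed

section \<open>Symmetry of second derivatives\<close>

text \<open>The mean value theorem for t \<mapsto> v(z + t e1 + h e2) - v(z + t e1) turns the second
  difference into h times an increment of \<open>V w e1\<close> between two points near
  \<open>z\<close>. The linearization \<open>P\<close> at \<open>z\<close> evaluates that increment
  as h P(e2) up to an error linear in h.\<close>

lemma second_difference_bound:
  fixes v :: "'a::real_normed_vector \<Rightarrow> real"
  assumes "open U" "z \<in> U"
    and v: "\<And>w. w \<in> U \<Longrightarrow> (v has_derivative V w) (at w)"
    and V: "((\<lambda>w. V w e1) has_derivative P) (at z)"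
    and e1: "norm e1 = 1" and e2: "norm e2 = 1" and "\<epsilon> > 0"
  shows "\<exists>d>0. \<forall>h. 0 < h \<and> h < d \<longrightarrow>
    \<bar>v (z + h *\<^sub>R e1 + h *\<^sub>R e2) - v (z + h *\<^sub>R e1) - v (z + h *\<^sub>R e2) + v z - h\<^sup>2 * P e2\<bar> \<le> 3 * \<epsilon> * h\<^sup>2"
proof -
  obtain d1 where "d1 > 0" and d1: "\<And>y. norm (y - z) < d1 \<Longrightarrow>
      \<bar>V y e1 - V z e1 - P (y - z)\<bar> \<le> \<epsilon> * norm (y - z)"
    using V \<open>\<epsilon> > 0\<close> unfolding has_derivative_at_alt by force
  obtain d2 where "d2 > 0" and d2: "ball z d2 \<subseteq> U"
    using \<open>open U\<close> \<open>z \<in> U\<close> open_contains_ball by blast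
  interpret P: bounded_linear P
    using V by (rule has_derivative_bounded_linear)
  show ?thesis
  \<comment> \<open>All points that occur lie within \<open>2 * h\<close> of \<open>z\<close>, hence
    the half.\<close>
  proof (intro exI[where x = "min d1 d2 / 2"] conjI allI impI)
    show "min d1 d2 / 2 > 0" using \<open>d1 > 0\<close> \<open>d2 > 0\<close> by simp
    fix h assume h: "0 < h \<and> h < min d1 d2 / 2"
    have n1: "norm (t *\<^sub>R e1 + s *\<^sub>R e2) \<le> t + s" if "0 \<le> t" "0 \<le> s" for t s
      using norm_triangle_ineq[of "t *\<^sub>R e1" "s *\<^sub>R e2"] that e1 e2 by simp
    have inU: "z + t *\<^sub>R e1 + s *\<^sub>R e2 \<in> U" if "0 \<le> t" "t \<le> h" "0 \<le> s" "s \<le> h" for t s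
    proof -
      have "norm (t *\<^sub>R e1 + s *\<^sub>R e2) < d2" using n1[of t s] that h by auto
      then have "z + t *\<^sub>R e1 + s *\<^sub>R e2 \<in> ball z d2"
        by (metis add.assoc add_diff_cancel_left' dist_commute dist_norm mem_ball)
      then show ?thesis using d2 by blast
    qed
    have der: "((\<lambda>t. v (z + t *\<^sub>R e1 + s *\<^sub>R e2)) has_real_derivative V (z + t *\<^sub>R e1 + s *\<^sub>R e2) e1) (at t)"
      if "0 \<le> t" "t \<le> h" "0 \<le> s" "s \<le> h" for t s
    proof -
      have "(v \<circ> (\<lambda>t. z + t *\<^sub>R e1 + s *\<^sub>R e2) has_derivative
          V (z + t *\<^sub>R e1 + s *\<^sub>R e2) \<circ> (\<lambda>t. t *\<^sub>R e1)) (at t)"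
        by (intro diff_chain_at v inU that) (auto intro!: derivative_eq_intros)
      moreover have "V (z + t *\<^sub>R e1 + s *\<^sub>R e2) (x *\<^sub>R e1) = x * V (z + t *\<^sub>R e1 + s *\<^sub>R e2) e1" for x
        using v[OF inU[OF that]] has_derivative_bounded_linear linear_simps(5) by fastforce
      ultimately show ?thesis
        unfolding has_field_derivative_def o_def
        by (elim has_derivative_eq_rhs) (simp add: fun_eq_iff mult.commute)
    qed
    \<comment> \<open>The zero multiples keep every term in the shape of \<open>der\<close>.\<close>
    have "\<exists>\<theta>>0. \<theta> < h \<and> (v (z + h *\<^sub>R e1 + h *\<^sub>R e2) - v (z + h *\<^sub>R e1 + 0 *\<^sub>R e2))
        - (v (z + 0 *\<^sub>R e1 + h *\<^sub>R e2) - v (z + 0 *\<^sub>R e1 + 0 *\<^sub>R e2))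
        = (h - 0) * (V (z + \<theta> *\<^sub>R e1 + h *\<^sub>R e2) e1 - V (z + \<theta> *\<^sub>R e1 + 0 *\<^sub>R e2) e1)"
      using h by (intro MVT2 DERIV_diff der) auto
    then obtain \<theta> where \<theta>: "0 < \<theta>" "\<theta> < h" and eq:
      "v (z + h *\<^sub>R e1 + h *\<^sub>R e2) - v (z + h *\<^sub>R e1) - v (z + h *\<^sub>R e2) + v z
       = h * (V (z + \<theta> *\<^sub>R e1 + h *\<^sub>R e2) e1 - V (z + \<theta> *\<^sub>R e1) e1)"
      by (auto simp: algebra_simps)
    have N1: "norm (\<theta> *\<^sub>R e1 + h *\<^sub>R e2) \<le> 2 * h" "norm (\<theta> *\<^sub>R e1) \<le> h"
      using n1[of \<theta> h] \<theta> e1 by auto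
    have "\<bar>V (z + \<theta> *\<^sub>R e1 + h *\<^sub>R e2) e1 - V z e1 - P (\<theta> *\<^sub>R e1 + h *\<^sub>R e2)\<bar> \<le> \<epsilon> * norm (\<theta> *\<^sub>R e1 + h *\<^sub>R e2)"
      using d1[of "z + \<theta> *\<^sub>R e1 + h *\<^sub>R e2"] N1 h by (simp add: add.assoc)
    also have "\<dots> \<le> \<epsilon> * (2 * h)"
      using N1 \<open>\<epsilon> > 0\<close> by (intro mult_left_mono) auto
    finally have b1: "\<bar>V (z + \<theta> *\<^sub>R e1 + h *\<^sub>R e2) e1 - V z e1 - P (\<theta> *\<^sub>R e1 + h *\<^sub>R e2)\<bar> \<le> \<epsilon> * (2 * h)" .
    have "\<bar>V (z + \<theta> *\<^sub>R e1) e1 - V z e1 - P (\<theta> *\<^sub>R e1)\<bar> \<le> \<epsilon> * norm (\<theta> *\<^sub>R e1)"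
      using d1[of "z + \<theta> *\<^sub>R e1"] N1 h by simp
    also have "\<dots> \<le> \<epsilon> * h"
      using N1 \<open>\<epsilon> > 0\<close> by (intro mult_left_mono) auto
    finally have b2: "\<bar>V (z + \<theta> *\<^sub>R e1) e1 - V z e1 - P (\<theta> *\<^sub>R e1)\<bar> \<le> \<epsilon> * h" .
    \<comment> \<open>By linearity of \<open>P\<close> the unknown \<theta> cancels from the
      difference of the two linearizations; the errors \<open>2 * h\<close> and \<open>h\<close> add
      up to the factor 3.\<close>
    have "\<bar>V (z + \<theta> *\<^sub>R e1 + h *\<^sub>R e2) e1 - V (z + \<theta> *\<^sub>R e1) e1 - h * P e2\<bar> \<le> 3 * \<epsilon> * h"
      using b1 b2 by (simp add: P.add P.scaleR)
    then have "h * \<bar>V (z + \<theta> *\<^sub>R e1 + h *\<^sub>R e2) e1 - V (z + \<theta> *\<^sub>R e1) e1 - h * P e2\<bar> \<le> h * (3 * \<epsilon> * h)"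
      using h by (intro mult_left_mono) auto
    moreover have "h * \<bar>V (z + \<theta> *\<^sub>R e1 + h *\<^sub>R e2) e1 - V (z + \<theta> *\<^sub>R e1) e1 - h * P e2\<bar>
      = \<bar>h * (V (z + \<theta> *\<^sub>R e1 + h *\<^sub>R e2) e1 - V (z + \<theta> *\<^sub>R e1) e1) - h\<^sup>2 * P e2\<bar>"
      using h by (simp add: abs_mult_pos' right_diff_distrib power2_eq_square mult.assoc)
    ultimately show "\<bar>v (z + h *\<^sub>R e1 + h *\<^sub>R e2) - v (z + h *\<^sub>R e1) - v (z + h *\<^sub>R e2) + v z - h\<^sup>2 * P e2\<bar>
        \<le> 3 * \<epsilon> * h\<^sup>2"
      unfolding eq by (simp add: power2_eq_square mult_ac)
  qed
qed

text \<open>The second difference does not change when \<open>e1\<close> and \<open>e2\<close> are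
  swapped, so after division by h^2 it tends both to \<open>P1 e2\<close> and to
  \<open>P2 e1\<close>.\<close>

lemma symmetric_second_derivative:
  fixes v :: "'a::real_normed_vector \<Rightarrow> real"
  assumes "open U" "z \<in> U"
    and v: "\<And>w. w \<in> U \<Longrightarrow> (v has_derivative V w) (at w)"
    and V1: "((\<lambda>w. V w e1) has_derivative P1) (at z)"
    and V2: "((\<lambda>w. V w e2) has_derivative P2) (at z)"
    and e1: "norm e1 = 1" and e2: "norm e2 = 1"
  shows "P1 e2 = P2 e1"
proof (rule ccontr)
  assume "P1 e2 \<noteq> P2 e1"
  \<comment> \<open>The two bounds together allow an error of 6\<epsilon>; a seventh of the supposed
    gap makes this too small.\<close>
  define \<epsilon> where "\<epsilon> = \<bar>P1 e2 - P2 e1\<bar> / 7"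
  have "\<epsilon> > 0" using \<open>P1 e2 \<noteq> P2 e1\<close> by (simp add: \<epsilon>_def)
  obtain d1 where "d1 > 0" and d1: "\<And>h. 0 < h \<Longrightarrow> h < d1 \<Longrightarrow>
    \<bar>v (z + h *\<^sub>R e1 + h *\<^sub>R e2) - v (z + h *\<^sub>R e1) - v (z + h *\<^sub>R e2) + v z - h\<^sup>2 * P1 e2\<bar> \<le> 3 * \<epsilon> * h\<^sup>2"
    using second_difference_bound[OF assms(1,2) v V1 e1 e2 \<open>\<epsilon> > 0\<close>] by blast
  obtain d2 where "d2 > 0" and d2: "\<And>h. 0 < h \<Longrightarrow> h < d2 \<Longrightarrow>
    \<bar>v (z + h *\<^sub>R e2 + h *\<^sub>R e1) - v (z + h *\<^sub>R e2) - v (z + h *\<^sub>R e1) + v z - h\<^sup>2 * P2 e1\<bar> \<le> 3 * \<epsilon> * h\<^sup>2"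
    using second_difference_bound[OF assms(1,2) v V2 e2 e1 \<open>\<epsilon> > 0\<close>] by blast
  define h where "h = min d1 d2 / 2"
  have h: "0 < h" "h < d1" "h < d2" using \<open>d1 > 0\<close> \<open>d2 > 0\<close> by (auto simp: h_def)
  have eq: "z + h *\<^sub>R e2 + h *\<^sub>R e1 = z + h *\<^sub>R e1 + h *\<^sub>R e2" by simp
  have "\<bar>h\<^sup>2 * P1 e2 - h\<^sup>2 * P2 e1\<bar> \<le> 6 * \<epsilon> * h\<^sup>2"
    using d1[OF h(1,2)] d2[OF h(1,3)] unfolding eq by linarith
  then have "h\<^sup>2 * \<bar>P1 e2 - P2 e1\<bar> \<le> h\<^sup>2 * (6 * \<epsilon>)"
    by (simp add: abs_mult flip: right_diff_distrib) (simp add: mult_ac)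
  then have "\<bar>P1 e2 - P2 e1\<bar> \<le> 6 * \<epsilon>" using h by simp
  then show False using \<open>\<epsilon> > 0\<close> by (simp add: \<epsilon>_def)
qed

section \<open>Harmonic functions as real parts, and their reflection\<close>

text \<open>Symmetry of the mixed derivatives and harmonicity are the Cauchy-Riemann equations for
  v_x - i v_y. A primitive of it exists by simple connectedness, and its real part differs from
  \<open>v\<close> by a constant.\<close>

lemma harmonic_imp_Re_holomorphic:
  fixes v p q r s s' t :: "complex \<Rightarrow> real"
  assumes U: "open U" "simply_connected U"
    and v: "\<And>z. z \<in> U \<Longrightarrow> has_partials v (p z) (q z) z"
    and p: "\<And>z. z \<in> U \<Longrightarrow> has_partials p (r z) (s z) z"
    and q: "\<And>z. z \<in> U \<Longrightarrow> has_partials q (s' z) (t z) z"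
    and harm: "\<And>z. z \<in> U \<Longrightarrow> r z + t z = 0"
  obtains G where "G holomorphic_on U" "\<And>z. z \<in> U \<Longrightarrow> v z = Re (G z)"
proof (cases "U = {}")
  case True
  then show thesis using that[of "\<lambda>_. 0"] by simp
next
  case False
  \<comment> \<open>The derivative that any holomorphic function with real part \<open>v\<close>
    must have.\<close>
  define g where "g = (\<lambda>z. of_real (p z) - \<i> * of_real (q z))"
  have "(g has_field_derivative (of_real (r z) - \<i> * of_real (s z))) (at z)" if "z \<in> U" for z
  proof -
    note sym = symmetric_second_derivative[OF U(1) that v, of 1 "\<lambda>h. Re h *\<^sub>R r z + Im h *\<^sub>R s z"
        \<i> "\<lambda>h. Re h *\<^sub>R s' z + Im h *\<^sub>R t z"]
    have "s z = s' z"
      using sym p[OF that] q[OF that] by simp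
    moreover have "t z = - r z" using harm[OF that] by simp
    moreover have "(g has_derivative (\<lambda>h. of_real (Re h *\<^sub>R r z + Im h *\<^sub>R s z)
        - \<i> * of_real (Re h *\<^sub>R s' z + Im h *\<^sub>R t z))) (at z)"
      unfolding g_def
      by (intro has_derivative_diff has_derivative_mult_right has_derivative_of_real p q that)
    ultimately show ?thesis
      unfolding has_field_derivative_def
      by (elim has_derivative_eq_rhs) (auto simp: fun_eq_iff complex_eq_iff algebra_simps)
  qed
  then have "g holomorphic_on U"
    using holomorphic_on_open[OF U(1)] by blast
  then obtain G where G: "\<And>z. z \<in> U \<Longrightarrow> (G has_field_derivative g z) (at z)"
    using simply_connected_eq_global_primitive[OF U(1)] U(2) by blast
  obtain z0 where "z0 \<in> U" using False by blast
  have "((\<lambda>z. v z - Re (G z)) has_derivative (\<lambda>h. 0)) (at z)" if "z \<in> U" for z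
  proof -
    \<comment> \<open>The two terms cancel, since \<open>Re (g z * h)\<close> is exactly the total
      derivative of \<open>v\<close> at \<open>z\<close> applied to \<open>h\<close>.\<close>
    have "((\<lambda>z. v z - Re (G z)) has_derivative
        (\<lambda>h. (Re h *\<^sub>R p z + Im h *\<^sub>R q z) - Re (g z * h))) (at z)"
      using G[OF that] unfolding has_field_derivative_def
      by (intro has_derivative_diff v that bounded_linear.has_derivative[OF bounded_linear_Re])
    then show ?thesis
      by (elim has_derivative_eq_rhs) (auto simp: fun_eq_iff g_def algebra_simps)
  qed
  then have "v z - Re (G z) = v z0 - Re (G z0)" if "z \<in> U" for z
    using has_derivative_zero_unique_connected[OF U(1) simply_connected_imp_connected[OF U(2)],
        of "\<lambda>z. v z - Re (G z)"] \<open>z0 \<in> U\<close> that by blast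
  \<comment> \<open>The real constant is absorbed into the primitive.\<close>
  then have "v z = Re (G z + of_real (v z0 - Re (G z0)))" if "z \<in> U" for z
    using that by (smt (verit) Re_complex_of_real plus_complex.sel(1))
  moreover have "(\<lambda>z. G z + of_real (v z0 - Re (G z0))) holomorphic_on U"
    using G holomorphic_on_open[OF U(1)] by (intro holomorphic_intros) blast
  ultimately show thesis using that by blast
qed

text \<open>Conjugation inside and outside makes \<open>cnj \<circ> G \<circ> cnj\<close>
  holomorphic on the conjugate domain, where \<open>S\<close> takes its values. On \<open>K\<close>,
  where \<open>S z\<close> is \<open>cnj z\<close>, the sum of \<open>G\<close> and this composite
  is 2 Re G = 0, and the limit point of \<open>K\<close> spreads the zero over
  \<open>U\<close>.\<close>

lemma harmonic_reflection:
  assumes U: "open U" "connected U"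
    and G: "G holomorphic_on U" and S: "S holomorphic_on U" "S ` U \<subseteq> cnj ` U"
    and K: "K \<subseteq> U" "\<xi> \<in> U" "\<xi> islimpt K"
    and SK: "\<And>z. z \<in> K \<Longrightarrow> S z = cnj z" and GK: "\<And>z. z \<in> K \<Longrightarrow> Re (G z) = 0"
    and "z \<in> U"
  shows "Re (G z) = - Re (G (cnj (S z)))"
proof -
  have "cnj \<circ> G \<circ> cnj holomorphic_on cnj ` U"
  proof (rule holomorphic_on_compose_cnj_cnj)
    show "G holomorphic_on cnj ` cnj ` U" using G by (simp add: image_image)
    show "open (cnj ` U)"
      unfolding image_cnj_conv_vimage_cnj using U by (intro open_vimage) auto
  qed
  then have "(cnj \<circ> G \<circ> cnj) \<circ> S holomorphic_on U"
    using S holomorphic_on_compose_gen by blast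
  then have "(\<lambda>z. G z + cnj (G (cnj (S z)))) holomorphic_on U"
    using G by (auto simp: o_def intro!: holomorphic_intros)
  moreover have "G z + cnj (G (cnj (S z))) = 0" if "z \<in> K" for z
    unfolding SK[OF that] using GK[OF that] by (simp add: complex_eq_iff)
  ultimately have "G z + cnj (G (cnj (S z))) = 0"
    using analytic_continuation[OF _ U K] \<open>z \<in> U\<close> by blast
  then show ?thesis by (simp add: complex_eq_iff)
qed

section \<open>An accumulation point of the curve\<close>

lemma reflection_neighbourhood_islimpt:
  assumes "reflection_neighbourhood f \<Gamma> S S' U"
  obtains \<xi> where "\<xi> \<in> \<Gamma> \<inter> U" "\<xi> islimpt \<Gamma> \<inter> U"
proof -
  from assms have U: "open U" "connected U" and K: "\<Gamma> \<inter> U \<noteq> {}" "connected (\<Gamma> \<inter> U)"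
    using simply_connected_imp_connected[of U] by (simp_all add: reflection_neighbourhood_def)
  obtain \<xi> where \<xi>: "\<xi> \<in> \<Gamma> \<inter> U" using K by blast
  have "\<Gamma> \<inter> U \<noteq> {\<xi>}"
  proof
    assume "\<Gamma> \<inter> U = {\<xi>}"
    then have "U - \<Gamma> = U - {\<xi>}" by blast
    moreover have "connected (U - {\<xi>})"
      by (rule connected_open_delete[OF U]) simp
    ultimately have "connected (U - \<Gamma>)" by simp
    \<comment> \<open>An inclusion rather than an equality: the empty set has no components at
      all.\<close>
    then have one: "components (U - \<Gamma>) \<subseteq> {U - \<Gamma>}"
    proof (cases "U - \<Gamma> = {}")
      case True
      show ?thesis unfolding True components_empty by simp
    next
      case False
      with \<open>connected (U - \<Gamma>)\<close> have "components (U - \<Gamma>) = {U - \<Gamma>}"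
        unfolding components_eq_sing_iff by simp
      then show ?thesis by simp
    qed
    have "\<exists>U1 U2. components (U - \<Gamma>) = {U1, U2} \<and> U1 \<noteq> U2 \<and>
        reflection S ` U1 = U2 \<and> reflection S ` U2 = U1"
      using assms by (simp only: reflection_neighbourhood_def)
    then obtain U1 U2 where "components (U - \<Gamma>) = {U1, U2}" "U1 \<noteq> U2"
      by (elim exE conjE)
    with one show False by (metis insert_subset singletonD)
  qed
  then have "\<Gamma> \<inter> U \<noteq> {x}" for x
    using \<xi> by (cases "x = \<xi>") auto
  then have "\<xi> islimpt \<Gamma> \<inter> U"
    by (rule connected_imp_perfect[OF K(2) \<xi>])
  with \<xi> show thesis by (rule that)
qed

section \<open>The exponential weight and rules for partial derivatives\<close>

text \<open>Multiplication by the weight replaces the partial derivatives by themselves plus a/2 and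
  b/2. Applied twice, this produces the first-order and zeroth-order terms of the equation.\<close>

lemma has_partials_mult_exp:
  fixes w :: "complex \<Rightarrow> complex" and a b :: complex
  assumes "has_partials w w1 w2 z"
  defines "E \<equiv> \<lambda>z. exp ((a * of_real (Re z) + b * of_real (Im z)) / 2)"
  shows "has_partials (\<lambda>z. w z * E z) ((w1 + a / 2 * w z) * E z) ((w2 + b / 2 * w z) * E z) z"
proof -
  have "(E has_derivative (\<lambda>h. (a * of_real (Re h) + b * of_real (Im h)) / 2 * E z)) (at z)"
  proof -
    \<comment> \<open>The exponent is real-linear in \<open>z\<close>, hence its own
      derivative.\<close>
    define L where "L = (\<lambda>z. a / 2 * of_real (Re z) + b / 2 * of_real (Im z))"
    have "(L has_derivative L) (at z)"
      unfolding L_def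
      by (intro has_derivative_add has_derivative_mult_right has_derivative_of_real
            bounded_linear_imp_has_derivative bounded_linear_Re bounded_linear_Im)
    then have "(exp \<circ> L has_derivative ((*) (exp (L z))) \<circ> L) (at z)"
      by (intro diff_chain_at DERIV_exp[unfolded has_field_derivative_def])
    then show ?thesis
      by (simp add: o_def E_def L_def add_divide_distrib mult.commute)
  qed
  from has_derivative_mult[OF assms(1) this] show ?thesis
    by (elim has_derivative_eq_rhs) (auto simp: fun_eq_iff scaleR_conv_of_real algebra_simps add_divide_distrib)
qed

lemma has_partials_add_cmult:
  fixes w v :: "complex \<Rightarrow> complex"
  assumes "has_partials w w1 w2 z" "has_partials v v1 v2 z"
  shows "has_partials (\<lambda>z. w z + c * v z) (w1 + c * v1) (w2 + c * v2) z"
  using has_derivative_add[OF assms(1) has_derivative_mult_right[OF assms(2), of c]]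
  by (elim has_derivative_eq_rhs) (auto simp: fun_eq_iff scaleR_conv_of_real algebra_simps)

lemma has_partials_Re_cmult:
  fixes w :: "complex \<Rightarrow> complex"
  assumes "has_partials w w1 w2 z"
  shows "has_partials (\<lambda>z. Re (c * w z)) (Re (c * w1)) (Re (c * w2)) z"
  using bounded_linear.has_derivative[OF bounded_linear_Re has_derivative_mult_right[OF assms, of c]]
  by (elim has_derivative_eq_rhs) (auto simp: fun_eq_iff algebra_simps)

section \<open>The reflection formula for the weighted solution and its translation to
  \<open>u\<close>\<close>

theorem theorem5p7:
  fixes a b A B :: complex
    and D \<Gamma> U :: "complex set"
    and f :: "complex \<Rightarrow> real"
    and S S' u :: "complex \<Rightarrow> complex"
    and x0 y0 :: real
    and P Q z0 \<zeta>0 :: complex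
  assumes "nonsingular_analytic_curve D f \<Gamma>"
    and "reflection_neighbourhood f \<Gamma> S S' U"
    and "C2_on U u"
    and "\<And>z. z \<in> U \<Longrightarrow>
           laplacian u z + a * partial_x u z + b * partial_y u z + (a\<^sup>2 + b\<^sup>2) / 4 * u z = 0"
    and "\<And>z. z \<in> \<Gamma> \<inter> U \<Longrightarrow> u z = 0"
    and "A = (a + \<i> * b) / 4" and "B = (a - \<i> * b) / 4"
    and "P = Complex x0 y0" and "P \<in> U"
    and "z0 = of_real x0 + \<i> * of_real y0" and "\<zeta>0 = of_real x0 - \<i> * of_real y0"
    and "Q = reflection S P"
  shows "u P = - exp (A * (S z0 - \<zeta>0) + B * (S' \<zeta>0 - z0)) * u Q"
proof -
  note rn = assms(2)
  from rn have U: "open U" "simply_connected U"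
    and S: "S holomorphic_on U" "S ` U \<subseteq> cnj ` U"
    and S'S: "\<And>z. z \<in> U \<Longrightarrow> S' (S z) = z"
    and RU: "\<And>z. z \<in> U \<Longrightarrow> cnj (S z) \<in> U"
    and RR: "\<And>z. z \<in> U \<Longrightarrow> cnj (S (cnj (S z))) = z"
    and R\<Gamma>: "\<And>z. z \<in> \<Gamma> \<inter> U \<Longrightarrow> cnj (S z) = z"
    by (auto simp: reflection_neighbourhood_def schwarz_pair_on_def reflection_def)
  obtain \<xi> where \<xi>: "\<xi> \<in> \<Gamma> \<inter> U" "\<xi> islimpt \<Gamma> \<inter> U"
    using reflection_neighbourhood_islimpt[OF rn] .
  define E where "E z = exp ((a * of_real (Re z) + b * of_real (Im z)) / 2)" for z
  note E = has_partials_mult_exp[of _ _ _ _ a b, folded E_def]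
  \<comment> \<open>With v = u E, these are v_x and v_y with the factor \<open>E\<close> taken
    out.\<close>
  define p where "p = (\<lambda>z. partial_x u z + a / 2 * u z)"
  define q where "q = (\<lambda>z. partial_y u z + b / 2 * u z)"
  have u1: "has_partials u (partial_x u z) (partial_y u z) z"
    and u2: "has_partials (partial_x u) (partial_x (partial_x u) z) (partial_y (partial_x u) z) z"
    and u3: "has_partials (partial_y u) (partial_x (partial_y u) z) (partial_y (partial_y u) z) z"
    if "z \<in> U" for z
    using \<open>C2_on U u\<close> C1_on_has_partials[OF U(1) _ that] by (auto simp: C2_on_def)
  \<comment> \<open>As \<open>u\<close>, \<open>a\<close> and \<open>b\<close> are complex,
    \<open>u z * E z\<close> is complex-valued; the factor \<open>c\<close> treats its real part (c
    = 1) and its imaginary part (c = -\<i>) at once.\<close>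
  have main: "Re (c * (u z * E z)) = - Re (c * (u (cnj (S z)) * E (cnj (S z))))" if "z \<in> U" for z c
  proof -
    have d0: "has_partials (\<lambda>z. Re (c * (u z * E z))) (Re (c * (p z * E z))) (Re (c * (q z * E z))) z"
      if "z \<in> U" for z
      using has_partials_Re_cmult[OF E[OF u1[OF that]], of c] by (simp add: p_def q_def)
    obtain G where G: "G holomorphic_on U" "\<And>z. z \<in> U \<Longrightarrow> Re (c * (u z * E z)) = Re (G z)"
    proof (rule harmonic_imp_Re_holomorphic[OF U d0 has_partials_Re_cmult[OF E] has_partials_Re_cmult[OF E]])
      show "has_partials p (partial_x (partial_x u) z + a / 2 * partial_x u z)
              (partial_y (partial_x u) z + a / 2 * partial_y u z) z" if "z \<in> U" for z
        unfolding p_def by (intro has_partials_add_cmult u1 u2 that)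
      show "has_partials q (partial_x (partial_y u) z + b / 2 * partial_x u z)
              (partial_y (partial_y u) z + b / 2 * partial_y u z) z" if "z \<in> U" for z
        unfolding q_def by (intro has_partials_add_cmult u1 u3 that)
      fix z assume "z \<in> U"
      let ?L = "partial_x (partial_x u) z + a / 2 * partial_x u z + a / 2 * p z"
      let ?M = "partial_y (partial_y u) z + b / 2 * partial_y u z + b / 2 * q z"
      \<comment> \<open>\<open>?L\<close> and \<open>?M\<close> are v_xx and v_yy without the factor
        \<open>E\<close>; expanding \<open>p\<close> and \<open>q\<close> makes their sum the left
        side of the differential equation.\<close>
      have "?L + ?M = 0"
        unfolding assms(4)[OF \<open>z \<in> U\<close>, symmetric]
        by (simp add: laplacian_def p_def q_def field_simps power2_eq_square)
      then have "Re (c * ((?L + ?M) * E z)) = 0" by simp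
      then show "Re (c * (?L * E z)) + Re (c * (?M * E z)) = 0"
        by (simp only: distrib_right distrib_left plus_complex.sel)
    qed auto
    have "Re (G z) = - Re (G (cnj (S z)))"
    proof (rule harmonic_reflection[OF U(1) simply_connected_imp_connected[OF U(2)] G(1) S _ _ \<xi>(2)])
      show "S w = cnj w" if "w \<in> \<Gamma> \<inter> U" for w
        using R\<Gamma>[OF that] by (metis complex_cnj_cnj)
      show "Re (G w) = 0" if "w \<in> \<Gamma> \<inter> U" for w
        using G(2)[of w] assms(5)[OF that] that by simp
    qed (use \<xi> \<open>z \<in> U\<close> in auto)
    then show ?thesis using G(2) RU \<open>z \<in> U\<close> by metis
  qed
  have PQ: "z0 = P" "\<zeta>0 = cnj P" "Q = cnj (S P)" "x0 = Re P" "y0 = Im P"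
    using assms(8,10,11,12) by (auto simp: complex_eq_iff reflection_def)
  have "u P * E P = - (u Q * E Q)"
    using main[OF \<open>P \<in> U\<close>, of 1] main[OF \<open>P \<in> U\<close>, of "- \<i>"] by (simp add: PQ complex_eq_iff)
  \<comment> \<open>The involution gives S(Q) = cnj P = \<zeta>0, and \<open>S'\<close> inverts
    \<open>S\<close> at \<open>Q\<close>.\<close>
  moreover have "S' \<zeta>0 = Q"
    using S'S[OF RU[OF \<open>P \<in> U\<close>]] RR[OF \<open>P \<in> U\<close>] by (metis PQ(2,3) complex_cnj_cnj)
  moreover have "S z0 = cnj Q" by (simp add: PQ)
  \<comment> \<open>By the choice of \<open>A\<close> and \<open>B\<close>, (a x + b y)/2 = A cnj z
    + B z, so the ratio of the weights at \<open>Q\<close> and \<open>P\<close> is the exponential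
    in the claim.\<close>
  moreover have "E Q = exp (A * (cnj Q - cnj P) + B * (Q - P)) * E P"
    unfolding E_def assms(6,7) exp_add[symmetric]
    by (rule arg_cong[where f = exp])
       (simp add: complex_eq_iff field_simps)
  moreover have "E P \<noteq> 0" by (simp add: E_def)
  ultimately have "u P * E P = (- exp (A * (S z0 - \<zeta>0) + B * (S' \<zeta>0 - z0)) * u Q) * E P"
    unfolding PQ(1,2) by (simp add: mult_ac)
  with \<open>E P \<noteq> 0\<close> show ?thesis by (metis mult_right_cancel)
qed

end
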